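(* Let $\mathscr{H}$ be a real Hilbert space, let $f:\mathscr{H}\to\mathbb{R}\cup\{+\infty\}$ be closed, convex and proper, and let $\rho\in\mathbb{R}$, $\rho\neq0$. Then the operator $\mathbf{Prox}_{f\rho}$ defined by $$\mathbf{Prox}_{f\rho}(\bm{v})=\operatorname*{argmin}_{\bm{z}\in\mathscr{H}}\; f(\rho\bm{z})+\tfrac12\|\bm{z}-\bm{v}\|^2$$ is single-valued and firmly nonexpansive.
   Context: An operator $\mathcal{T}:\mathscr{H}\to\mathscr{H}$ is firmly nonexpansive if $\|\mathcal{T}\bm{x}-\mathcal{T}\bm{y}\|^2\le\langle\mathcal{T}\bm{x}-\mathcal{T}\bm{y},\bm{x}-\bm{y}\rangle$ for all $\bm{x},\bm{y}\in\mathscr{H}$. Single-valued means that for every $\bm{v}\in\mathscr{H}$ the set of minimizers consists of exactly one point. *)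

theory Defs
  imports "HOL-Analysis.Analysis"
begin

text \<open>
  A function into \<open>\<real> \<union> {+\<infinity>}\<close> is an \<^typ>\<open>ereal\<close>-valued function that never takes the
  value \<open>-\<infinity>\<close>. This restriction is part of properness.
\<close>

definition ext_proper :: "('a \<Rightarrow> ereal) \<Rightarrow> bool" where
  "ext_proper f \<longleftrightarrow> (\<forall>x. f x \<noteq> -\<infinity>) \<and> (\<exists>x. f x \<noteq> \<infinity>)"

text \<open>
  For \<open>f > -\<infinity>\<close> the right-hand side never has the form \<open>\<infinity> - \<infinity>\<close>. At the end points
  \<open>t = 0\<close> and \<open>t = 1\<close> the convention \<open>0 * \<infinity> = 0\<close> makes the inequality trivial.
\<close>

definition ext_convex :: "('a::real_vector \<Rightarrow> ereal) \<Rightarrow> bool" where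
  "ext_convex f \<longleftrightarrow>
     (\<forall>x y. \<forall>t\<in>{0..1::real}.
        f ((1 - t) *\<^sub>R x + t *\<^sub>R y) \<le> ereal (1 - t) * f x + ereal t * f y)"

text \<open>The library's \<open>epigraph\<close> is restricted to real-valued functions.\<close>

definition ext_epigraph :: "('a \<Rightarrow> ereal) \<Rightarrow> ('a \<times> real) set" where
  "ext_epigraph f = {(x, r). f x \<le> ereal r}"

definition ext_closed :: "('a::topological_space \<Rightarrow> ereal) \<Rightarrow> bool" where
  "ext_closed f \<longleftrightarrow> closed (ext_epigraph f)"

definition argmin_set :: "('a \<Rightarrow> 'b::ord) \<Rightarrow> 'a set" where
  "argmin_set g = {z. is_arg_min g (\<lambda>_. True) z}"

definition prox :: "('a::real_inner \<Rightarrow> ereal) \<Rightarrow> real \<Rightarrow> 'a \<Rightarrow> 'a set" where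
  "prox f \<rho> v = argmin_set (\<lambda>z. f (\<rho> *\<^sub>R z) + ereal (1 / 2 * (norm (z - v))\<^sup>2))"

definition firmly_nonexpansive :: "('a::real_inner \<Rightarrow> 'a) \<Rightarrow> bool" where
  "firmly_nonexpansive T \<longleftrightarrow> (\<forall>x y. (norm (T x - T y))\<^sup>2 \<le> (T x - T y) \<bullet> (x - y))"

end

(* A closed convex proper f is bounded below near a point of its domain, and convexity spreads this
   to a bound of the form a - b * norm (z - v) on the whole space. The objective of the proximal
   problem is therefore bounded below. It is strongly convex, so minimizing sequences are Cauchy and
   their limit is a minimizer because the epigraph is closed. Comparing a minimizer p with the points
   of the segment from p to z shows that v - p is a subgradient of f at p; monotonicity of the
   subgradient gives both uniqueness and firm nonexpansiveness. *)
theory Submission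
  imports Defs
begin

text \<open>Working with real upper bounds, that is, with points of the epigraph, keeps later
  estimates in real arithmetic without case splits on infinite values.\<close>

lemma ext_convexD:
  assumes "ext_convex f" "f x \<le> ereal r" "f y \<le> ereal s" "0 \<le> t" "t \<le> 1"
  shows "f ((1 - t) *\<^sub>R x + t *\<^sub>R y) \<le> ereal ((1 - t) * r + t * s)"
proof -
  have "f ((1 - t) *\<^sub>R x + t *\<^sub>R y) \<le> ereal (1 - t) * f x + ereal t * f y"
    using assms by (simp add: ext_convex_def)
  also have "\<dots> \<le> ereal (1 - t) * ereal r + ereal t * ereal s"
    using assms by (intro add_mono ereal_mult_left_mono) auto
  finally show ?thesis by simp
qed

lemma ext_properE:
  assumes "ext_proper f"
  obtains x r where "f x = ereal r"
proof -
  obtain x where "f x \<noteq> \<infinity>" "f x \<noteq> -\<infinity>"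
    using assms by (auto simp: ext_proper_def)
  then show thesis using that by (cases "f x") auto
qed

lemma ext_closed_scaleR:
  fixes f :: "'a::real_normed_vector \<Rightarrow> ereal"
  assumes "ext_closed f"
  shows "ext_closed (\<lambda>z. f (c *\<^sub>R z))"
proof -
  have "ext_epigraph (\<lambda>z. f (c *\<^sub>R z)) = (\<lambda>p. (c *\<^sub>R fst p, snd p)) -` ext_epigraph f"
    by (auto simp: ext_epigraph_def)
  moreover have "closed ((\<lambda>p. (c *\<^sub>R fst p, snd p)) -` ext_epigraph f)"
    using assms unfolding ext_closed_def
    by (intro closed_vimage continuous_intros) auto
  ultimately show ?thesis by (simp add: ext_closed_def)
qed

lemma ext_convex_scaleR:
  fixes f :: "'a::real_vector \<Rightarrow> ereal"
  assumes "ext_convex f"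
  shows "ext_convex (\<lambda>z. f (c *\<^sub>R z))"
proof -
  have "c *\<^sub>R ((1 - t) *\<^sub>R x + t *\<^sub>R y) = (1 - t) *\<^sub>R (c *\<^sub>R x) + t *\<^sub>R (c *\<^sub>R y)" for t and x y :: 'a
    by (simp add: scaleR_add_right mult.commute)
  then show ?thesis using assms unfolding ext_convex_def by metis
qed

lemma ext_proper_scaleR:
  fixes f :: "'a::real_vector \<Rightarrow> ereal"
  assumes "ext_proper f" "c \<noteq> 0"
  shows "ext_proper (\<lambda>z. f (c *\<^sub>R z))"
proof -
  obtain x where "f x \<noteq> \<infinity>" using assms(1) by (auto simp: ext_proper_def)
  then have "f (c *\<^sub>R (inverse c *\<^sub>R x)) \<noteq> \<infinity>" using assms(2) by simp
  then show ?thesis using assms(1) unfolding ext_proper_def by blast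
qed

text \<open>Sequential lower semicontinuity, with bounds allowed to vary along the sequence as they
  do for a minimizing sequence.\<close>

lemma ext_closed_limit:
  assumes "ext_closed f" "\<And>n. f (X n) \<le> ereal (R n)" "X \<longlonglongrightarrow> x" "R \<longlonglongrightarrow> r"
  shows "f x \<le> ereal r"
proof -
  have "(x, r) \<in> ext_epigraph f"
    using assms(1,2) tendsto_Pair[OF assms(3,4)] unfolding ext_closed_def
    by (elim closed_sequentially) (auto simp: ext_epigraph_def)
  then show ?thesis by (simp add: ext_epigraph_def)
qed

text \<open>If \<open>f\<close> fell too fast away from \<open>x0\<close>, convexity on the segment
  from \<open>x0\<close> to the offending point would push it below \<open>r0 - 1\<close> close to
  \<open>x0\<close>.\<close>

lemma ext_convex_norm_minorant:
  fixes f :: "'a::real_normed_vector \<Rightarrow> ereal"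
  assumes "ext_closed f" "ext_convex f" "ext_proper f"
  obtains a b where "\<And>z r. f z \<le> ereal r \<Longrightarrow> a - b * norm (z - v) \<le> r"
proof -
  obtain x0 r0 where x0: "f x0 = ereal r0" using assms(3) by (rule ext_properE)
  \<comment> \<open>A point strictly below the graph has a whole ball outside the closed epigraph;
    the slice of that ball at height \<open>r0 - 1\<close> bounds \<open>f\<close> from below near
    \<open>x0\<close>.\<close>
  have "(x0, r0 - 1) \<in> - ext_epigraph f" by (simp add: x0 ext_epigraph_def)
  then obtain e where e: "e > 0" "ball (x0, r0 - 1) e \<subseteq> - ext_epigraph f"
    using assms(1) unfolding ext_closed_def closed_def by (metis open_contains_ball)
  have near: "ereal (r0 - 1) < f x" if "norm (x - x0) < e" for x
  proof -
    have "(x, r0 - 1) \<in> ball (x0, r0 - 1) e"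
      using that by (simp add: dist_Pair_Pair dist_norm norm_minus_commute)
    then show ?thesis using e(2) by (auto simp: ext_epigraph_def)
  qed
  define d where "d = e / 2"
  have d: "0 < d" "d < e" using e(1) by (auto simp: d_def)
  have bound: "r0 - 1 - norm (z - x0) / d \<le> r" if z: "f z \<le> ereal r" for z r
  proof (cases "norm (z - x0) \<le> d")
    case True
    then have "ereal (r0 - 1) < ereal r" using near[of z] d z by (meson le_less_trans less_le_trans)
    then show ?thesis using d by (smt (verit) divide_nonneg_pos less_ereal.simps(1) norm_ge_zero)
  next
    case False
    define n where "n = norm (z - x0)"
    \<comment> \<open>This \<open>t\<close> puts the point of the segment at distance exactly
      \<open>d\<close> from \<open>x0\<close>, inside the ball of radius \<open>e\<close>.\<close>
    define t where "t = d / n"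
    have n: "d < n" "0 < n" using False d by (auto simp: n_def)
    have t: "0 < t" "t \<le> 1" using n d by (auto simp: t_def)
    have "(1 - t) *\<^sub>R x0 + t *\<^sub>R z - x0 = t *\<^sub>R (z - x0)" by (simp add: algebra_simps)
    then have "norm ((1 - t) *\<^sub>R x0 + t *\<^sub>R z - x0) = d"
      using t n d by (simp add: t_def n_def)
    then have "ereal (r0 - 1) < f ((1 - t) *\<^sub>R x0 + t *\<^sub>R z)" using near d by simp
    also have "\<dots> \<le> ereal ((1 - t) * r0 + t * r)"
      using ext_convexD[OF assms(2) _ z] x0 t by simp
    finally have "t * (r0 - r) < 1" by (simp add: algebra_simps)
    then have "r0 - r < n / d" using t n d by (simp add: t_def field_simps)
    then show ?thesis by (simp add: n_def)
  qed
  \<comment> \<open>The triangle inequality moves the centre from \<open>x0\<close> to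
    \<open>v\<close>, at the cost of a constant.\<close>
  have "r0 - 1 - norm (v - x0) / d - 1 / d * norm (z - v) \<le> r" if "f z \<le> ereal r" for z r
  proof -
    have "norm (z - x0) \<le> norm (z - v) + norm (v - x0)"
      by (metis diff_add_cancel add_diff_eq norm_triangle_ineq)
    then have "norm (z - x0) / d \<le> norm (z - v) / d + norm (v - x0) / d"
      using d by (simp add: divide_right_mono flip: add_divide_distrib)
    then show ?thesis using bound[OF that] by simp
  qed
  then show thesis by (rule that)
qed

lemma mem_prox_iff:
  "p \<in> prox f \<rho> v \<longleftrightarrow>
    (\<forall>z. f (\<rho> *\<^sub>R p) + ereal (1 / 2 * (norm (p - v))\<^sup>2)
       \<le> f (\<rho> *\<^sub>R z) + ereal (1 / 2 * (norm (z - v))\<^sup>2))"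
  by (simp add: prox_def argmin_set_def is_arg_min_linorder)

text \<open>The parallelogram law for \<open>x - v\<close> and \<open>y - v\<close>. The negative
  term is the strong convexity that forces minimizing sequences to be Cauchy; the coefficient
  \<open>1 - 1 / 2\<close> matches \<open>ext_convexD\<close> at \<open>t = 1 / 2\<close>.\<close>

lemma norm_midpoint_sq:
  fixes x y v :: "'a::real_inner"
  shows "(norm ((1 - 1 / 2) *\<^sub>R x + (1 / 2) *\<^sub>R y - v))\<^sup>2
    = (norm (x - v))\<^sup>2 / 2 + (norm (y - v))\<^sup>2 / 2 - (norm (x - y))\<^sup>2 / 4"
  by (simp add: power2_norm_eq_inner algebra_simps inner_commute add_divide_distrib
      diff_divide_distrib)

lemma prox_nonempty:
  fixes f :: "'a::{real_inner, complete_space} \<Rightarrow> ereal"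
  assumes "ext_closed f" "ext_convex f" "ext_proper f"
  shows "\<exists>p. p \<in> prox f 1 v"
proof -
  obtain a b where ab: "\<And>z r. f z \<le> ereal r \<Longrightarrow> a - b * norm (z - v) \<le> r"
    using ext_convex_norm_minorant[OF assms, of v] by blast
  \<comment> \<open>Ranging over epigraph points makes this a set of reals with the same infimum as
    the objective.\<close>
  define S where "S = {r + 1 / 2 * (norm (z - v))\<^sup>2 | z r. f z \<le> ereal r}"
  obtain x0 r0 where "f x0 = ereal r0" using assms(3) by (rule ext_properE)
  then have "r0 + 1 / 2 * (norm (x0 - v))\<^sup>2 \<in> S"
    unfolding S_def by (intro CollectI exI[of _ x0] exI[of _ r0]) simp
  then have ne: "S \<noteq> {}" by blast
  have "a - b\<^sup>2 / 2 \<le> s" if s: "s \<in> S" for s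
  proof -
    obtain z r where zr: "f z \<le> ereal r" "s = r + 1 / 2 * (norm (z - v))\<^sup>2"
      using s by (auto simp: S_def)
    \<comment> \<open>Completing the square: half the squared norm outweighs the linear loss up to
      \<open>b\<^sup>2 / 2\<close>.\<close>
    have "0 \<le> (norm (z - v) - b)\<^sup>2" by simp
    then show ?thesis using ab[OF zr(1)] zr(2) by (simp add: power2_diff algebra_simps)
  qed
  then have bdd: "bdd_below S" by (auto simp: bdd_below_def)
  define m where "m = Inf S"
  have m_le: "m \<le> r + 1 / 2 * (norm (z - v))\<^sup>2" if "f z \<le> ereal r" for z r
    unfolding m_def using that bdd by (intro cInf_lower) (auto simp: S_def)
  have "\<exists>z r. f z \<le> ereal r \<and> r + 1 / 2 * (norm (z - v))\<^sup>2 < m + inverse (Suc n)" for n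
  proof -
    have "\<exists>s\<in>S. s < m + inverse (Suc n)"
      using cInf_lessD[OF ne, of "m + inverse (Suc n)"] by (auto simp: m_def)
    then show ?thesis by (auto simp: S_def)
  qed
  then obtain X R where XR: "\<And>n. f (X n) \<le> ereal (R n)"
    "\<And>n. R n + 1 / 2 * (norm (X n - v))\<^sup>2 < m + inverse (Suc n)"
    by metis
  \<comment> \<open>The objective at the midpoint is at least \<open>m\<close>, yet at most the
    average of the two values minus an eighth of the squared distance.\<close>
  have close: "(norm (X i - X j))\<^sup>2 \<le> 4 * (inverse (Suc i) + inverse (Suc j))" for i j
    using m_le[OF ext_convexD[OF assms(2) XR(1)[of i] XR(1)[of j], of "1 / 2"]]
      XR(2)[of i] XR(2)[of j]
    unfolding norm_midpoint_sq by (simp add: add_divide_distrib diff_divide_distrib)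
  have "Cauchy X"
  proof (rule metric_CauchyI)
    fix e :: real assume e: "0 < e"
    obtain N where N: "inverse (Suc N) < e\<^sup>2 / 8"
      using reals_Archimedean[of "e\<^sup>2 / 8"] e by auto
    have "dist (X i) (X j) < e" if "N \<le> i" "N \<le> j" for i j
    proof -
      have "inverse (real (Suc i)) + inverse (real (Suc j)) \<le> inverse (Suc N) + inverse (Suc N)"
        using that by (intro add_mono le_imp_inverse_le) auto
      also have "\<dots> < e\<^sup>2 / 8 + e\<^sup>2 / 8" using N N by (rule add_strict_mono)
      finally have "4 * (inverse (real (Suc i)) + inverse (real (Suc j))) < e\<^sup>2" by simp
      then have "(norm (X i - X j))\<^sup>2 < e\<^sup>2" using close[of i j] by (rule le_less_trans[rotated])
      then show ?thesis using e by (simp add: dist_norm power_less_imp_less_base)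
    qed
    then show "\<exists>M. \<forall>i\<ge>M. \<forall>j\<ge>M. dist (X i) (X j) < e" by blast
  qed
  then obtain p where p: "X \<longlonglongrightarrow> p" using Cauchy_convergent convergent_def by blast
  have "(\<lambda>n. m + inverse (Suc n) - 1 / 2 * (norm (X n - v))\<^sup>2)
      \<longlonglongrightarrow> m + 0 - 1 / 2 * (norm (p - v))\<^sup>2"
    by (intro tendsto_intros LIMSEQ_inverse_real_of_nat p)
  \<comment> \<open>Moving the quadratic term to the right gives convergent bounds on
    \<open>f (X n)\<close>, so closedness applies.\<close>
  moreover have "f (X n) \<le> ereal (m + inverse (Suc n) - 1 / 2 * (norm (X n - v))\<^sup>2)" for n
    using XR[of n] by (meson dual_order.trans ereal_less_eq(3) less_diff_eq less_imp_le)
  ultimately have fp: "f p \<le> ereal (m - 1 / 2 * (norm (p - v))\<^sup>2)"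
    using ext_closed_limit[OF assms(1) _ p] by fastforce
  have "f p + ereal (1 / 2 * (norm (p - v))\<^sup>2) \<le> f z + ereal (1 / 2 * (norm (z - v))\<^sup>2)" for z
  proof (cases "f z")
    case (real r)
    have "f p + ereal (1 / 2 * (norm (p - v))\<^sup>2) \<le> ereal m"
      using add_right_mono[OF fp, of "ereal (1 / 2 * (norm (p - v))\<^sup>2)"] by simp
    also have "\<dots> \<le> f z + ereal (1 / 2 * (norm (z - v))\<^sup>2)"
      using m_le[of z r] real by simp
    finally show ?thesis .
  qed (use assms(3) in \<open>auto simp: ext_proper_def\<close>)
  then show ?thesis by (auto simp: mem_prox_iff)
qed

lemma prox_finite:
  assumes "ext_proper f" "p \<in> prox f 1 v"
  obtains r where "f p = ereal r"
proof -
  obtain x0 r0 where x0: "f x0 = ereal r0" using assms(1) by (rule ext_properE)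
  have "f p + ereal (1 / 2 * (norm (p - v))\<^sup>2) \<le> f x0 + ereal (1 / 2 * (norm (x0 - v))\<^sup>2)"
    using assms(2) unfolding mem_prox_iff by simp
  then have "f p \<noteq> \<infinity>" using x0 by auto
  moreover have "f p \<noteq> -\<infinity>" using assms(1) by (simp add: ext_proper_def)
  ultimately show thesis using that by (cases "f p") auto
qed

text \<open>A step of length \<open>t\<close> from \<open>p\<close> towards \<open>z\<close> changes
  \<open>f\<close> by at most \<open>t * (s - r)\<close> and the quadratic by
  \<open>t * ((p - v) \<bullet> (z - p))\<close> up to order \<open>t * t\<close>. Minimality makes
  the total nonnegative; divide by \<open>t\<close> and let it tend to 0.\<close>

lemma prox_subgradient:
  fixes f :: "'a::real_inner \<Rightarrow> ereal"
  assumes "ext_convex f" "p \<in> prox f 1 v" and fp: "f p = ereal r" and fz: "f z = ereal s"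
  shows "r + (v - p) \<bullet> (z - p) \<le> s"
proof -
  have norm_sq: "(norm (u + t *\<^sub>R w))\<^sup>2 = (norm u)\<^sup>2 + 2 * t * (u \<bullet> w) + t * t * (norm w)\<^sup>2"
    for u w :: 'a and t :: real
    by (simp add: power2_norm_eq_inner inner_add_left inner_add_right inner_commute)
  have "r + (v - p) \<bullet> (z - p) \<le> s + t / 2 * (norm (z - p))\<^sup>2" if t: "0 < t" "t < 1" for t
  proof -
    define q where "q = (1 - t) *\<^sub>R p + t *\<^sub>R z"
    have "f p + ereal (1 / 2 * (norm (p - v))\<^sup>2) \<le> f q + ereal (1 / 2 * (norm (q - v))\<^sup>2)"
      using assms(2) unfolding mem_prox_iff by simp
    also have "\<dots> \<le> ereal ((1 - t) * r + t * s) + ereal (1 / 2 * (norm (q - v))\<^sup>2)"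
      unfolding q_def using t fp fz by (intro add_right_mono ext_convexD[OF assms(1)]) auto
    finally have "r + (norm (p - v))\<^sup>2 / 2 \<le> (1 - t) * r + t * s + (norm (q - v))\<^sup>2 / 2"
      by (simp add: fp)
    moreover have "q - v = (p - v) + t *\<^sub>R (z - p)" by (simp add: q_def algebra_simps)
    then have "(norm (q - v))\<^sup>2
        = (norm (p - v))\<^sup>2 - 2 * t * ((v - p) \<bullet> (z - p)) + t * t * (norm (z - p))\<^sup>2"
      using inner_minus_left[of "p - v" "z - p"] by (simp only: norm_sq minus_diff_eq)
    ultimately have "t * (r + (v - p) \<bullet> (z - p)) \<le> t * (s + t / 2 * (norm (z - p))\<^sup>2)"
      by (simp add: distrib_left left_diff_distrib add_divide_distrib diff_divide_distrib)
    then show ?thesis using t by simp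
  qed
  then have "eventually (\<lambda>t. r + (v - p) \<bullet> (z - p) \<le> s + t / 2 * (norm (z - p))\<^sup>2) (at_right 0)"
    unfolding eventually_at_right_field by (intro exI[of _ 1]) auto
  moreover have "((\<lambda>t. s + t / 2 * (norm (z - p))\<^sup>2) \<longlongrightarrow> s + 0 / 2 * (norm (z - p))\<^sup>2) (at_right 0)"
    by (intro tendsto_intros) auto
  ultimately have "r + (v - p) \<bullet> (z - p) \<le> s + 0 / 2 * (norm (z - p))\<^sup>2"
    by (intro tendsto_lowerbound) auto
  then show ?thesis by simp
qed

text \<open>Testing the subgradient at \<open>p\<close> with \<open>q\<close> and the one at
  \<open>q\<close> with \<open>p\<close>, the values of \<open>f\<close> cancel in the sum.
  Arbitrary minimizers are allowed, so that \<open>v = w\<close> yields uniqueness.\<close>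

lemma prox_firmly_nonexpansive:
  assumes "ext_convex f" "ext_proper f" and p: "p \<in> prox f 1 v" and q: "q \<in> prox f 1 w"
  shows "(norm (p - q))\<^sup>2 \<le> (p - q) \<bullet> (v - w)"
proof -
  obtain r where r: "f p = ereal r" using assms(2) p by (rule prox_finite)
  obtain s where s: "f q = ereal s" using assms(2) q by (rule prox_finite)
  have "(v - p) \<bullet> (q - p) + (w - q) \<bullet> (p - q) \<le> 0"
    using prox_subgradient[OF assms(1) p r s] prox_subgradient[OF assms(1) q s r] by simp
  then show ?thesis
    by (simp add: power2_norm_eq_inner inner_diff_left inner_diff_right inner_commute)
qed

theorem proposition2p1:
  fixes f :: "'a::{real_inner, complete_space} \<Rightarrow> ereal" and \<rho> :: real
  assumes "ext_closed f" and "ext_convex f" and "ext_proper f"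
    and "\<rho> \<noteq> 0"
  shows "(\<forall>v. \<exists>!z. z \<in> prox f \<rho> v) \<and> firmly_nonexpansive (\<lambda>v. the_elem (prox f \<rho> v))"
proof -
  \<comment> \<open>Absorbing the scaling into the function leaves the quadratic in \<open>z\<close>
    unchanged and reduces to parameter 1; properness survives because
    \<open>\<rho> \<noteq> 0\<close>.\<close>
  define g where "g = (\<lambda>z. f (\<rho> *\<^sub>R z))"
  have g: "ext_closed g" "ext_convex g" "ext_proper g"
    unfolding g_def using assms
    by (auto intro: ext_closed_scaleR ext_convex_scaleR ext_proper_scaleR)
  have prox_g: "prox f \<rho> = prox g 1" by (simp add: prox_def g_def fun_eq_iff)
  have unique: "\<exists>!z. z \<in> prox g 1 v" for v
  proof (rule ex_ex1I)
    show "\<exists>z. z \<in> prox g 1 v" using g by (rule prox_nonempty)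
  next
    fix p q assume "p \<in> prox g 1 v" "q \<in> prox g 1 v"
    then show "p = q" using prox_firmly_nonexpansive[OF g(2,3), of p v q v] by simp
  qed
  \<comment> \<open>\<open>the_elem\<close> is specified only on singletons, so uniqueness is what
    makes its value a minimizer.\<close>
  have "the_elem (prox g 1 v) \<in> prox g 1 v" for v
    using unique[of v] by (metis is_singletonI' is_singleton_the_elem singletonI empty_iff)
  then have "firmly_nonexpansive (\<lambda>v. the_elem (prox g 1 v))"
    unfolding firmly_nonexpansive_def using prox_firmly_nonexpansive[OF g(2,3)] by blast
  then show ?thesis using unique by (simp add: prox_g)
qed

end
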